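(* Let $M$ and $N$ be two monoids. Let $A$ be an $M$-act defined by a finite presentation $\langle X\,|\,R\rangle$, and let $B$ be any finitely presented $N$-act. Suppose there exists a finite set $U\subseteq N^A$ such that for every $\theta\in N^A$ and every $x\in X$, either $\theta=c_{x\theta}$ or $\theta$ is $(U,x)$-connected to $c_{x\theta}$. Then the $\mathcal{W}(M,N|A)$-act $A\wr B$ is finitely presented.
   Context: For a monoid $M$ with identity $1$, an $M$-act is a non-empty set $A$ with a map $A\times M\to A$, $(a,m)\mapsto am$, such that $a(mn)=(am)n$ and $a1=a$. For a non-empty set $X$, $F_X$ is the free $M$-act $X\times M$ with action $(x,m)n=(x,mn)$. A congruence on an $M$-act is an equivalence relation $\rho$ such that $(a,b)\in\rho$ implies $(am,bm)\in\rho$ for all $m\in M$. An $M$-act $A$ is defined by the presentation $\langle X\,|\,R\rangle$, where $R\subseteq F_X\times F_X$, if $A\cong F_X/\rho$ with $\rho$ the smallest congruence on $F_X$ containing $R$; the presentation is finite if $X$ and $R$ are finite, and $A$ is finitely presented if it is defined by some finite presentation. A generator $x\in X$ also denotes the element of $A$ it represents. Wreath products: let $M,N$ be monoids, $A$ an $M$-act, $B$ an $N$-act. $N^A$ is the monoid of all maps $A\to N$ (written on the right) under pointwise multiplication $a(\theta\phi)=(a\theta)(a\phi)$; $c_n\in N^A$ is the constant map with value $n$. For $m\in M$ and $\phi\in N^A$, ${}^m\phi\in N^A$ is given by $a\,{}^m\phi=(am)\phi$. The monoid $\mathcal{W}(M,N|A)$ is the set $M\times N^A$ with multiplication $(m,\theta)(n,\phi)=(mn,\theta\,{}^m\phi)$.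 The wreath product $A\wr B$ is the $\mathcal{W}(M,N|A)$-act with underlying set $A\times B$ and action $(a,b)(m,\theta)=(am,b(a\theta))$. Connectedness: for $a\in A$, $U\subseteq N^A$ and $\theta,\phi\in N^A$, $\theta$ is $(U,a)$-connected to $\phi$ if there is a sequence $\theta=\theta_1\psi_1,\ \phi_1\psi_1=\theta_2\psi_2,\ \dots,\ \phi_k\psi_k=\phi$, where each $\psi_i\in N^A$ and, for each $i\in\{1,\dots,k\}$, either $\theta_i\in U$ and $\phi_i=c_{a\theta_i}$, or $\phi_i\in U$ and $\theta_i=c_{a\phi_i}$. *)

theory Defs
  imports "HOL-Algebra.Product_Groups"
begin

section \<open>Right acts over a monoid\<close>

record ('a, 'm) mact = "'a partial_object" +
  act :: "'a \<Rightarrow> 'm \<Rightarrow> 'a"  (infixl "\<cdot>\<index>" 70)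

locale monoid_act = monoid M for M :: "('m, 'k) monoid_scheme" (structure) +
  fixes A :: "('a, 'm, 'l) mact_scheme"
  assumes nonempty: "carrier A \<noteq> {}"
    and act_closed: "\<lbrakk>a \<in> carrier A; m \<in> carrier M\<rbrakk> \<Longrightarrow> a \<cdot>\<^bsub>A\<^esub> m \<in> carrier A"
    and act_mult: "\<lbrakk>a \<in> carrier A; m \<in> carrier M; n \<in> carrier M\<rbrakk>
      \<Longrightarrow> a \<cdot>\<^bsub>A\<^esub> (m \<otimes> n) = (a \<cdot>\<^bsub>A\<^esub> m) \<cdot>\<^bsub>A\<^esub> n"
    and act_one: "a \<in> carrier A \<Longrightarrow> a \<cdot>\<^bsub>A\<^esub> \<one> = a"

definition act_iso ::
    "('m, 'k) monoid_scheme \<Rightarrow> ('a, 'm, 'l) mact_scheme \<Rightarrow> ('b, 'm, 'j) mact_scheme \<Rightarrow> ('a \<Rightarrow> 'b) set" where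
  "act_iso M A B = {h. bij_betw h (carrier A) (carrier B) \<and>
     (\<forall>a\<in>carrier A. \<forall>m\<in>carrier M. h (a \<cdot>\<^bsub>A\<^esub> m) = h a \<cdot>\<^bsub>B\<^esub> m)}"

definition act_congruence ::
    "('m, 'k) monoid_scheme \<Rightarrow> ('a, 'm, 'l) mact_scheme \<Rightarrow> ('a \<times> 'a) set \<Rightarrow> bool" where
  "act_congruence M A \<rho> \<longleftrightarrow> equiv (carrier A) \<rho> \<and>
     (\<forall>a b. (a, b) \<in> \<rho> \<longrightarrow> (\<forall>m\<in>carrier M. (a \<cdot>\<^bsub>A\<^esub> m, b \<cdot>\<^bsub>A\<^esub> m) \<in> \<rho>))"

definition generated_congruence ::
    "('m, 'k) monoid_scheme \<Rightarrow> ('a, 'm, 'l) mact_scheme \<Rightarrow> ('a \<times> 'a) set \<Rightarrow> ('a \<times> 'a) set" where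
  "generated_congruence M A R = \<Inter> {\<rho>. act_congruence M A \<rho> \<and> R \<subseteq> \<rho>}"

text \<open>For a congruence \<open>\<rho>\<close> and \<open>C\<close> the class of \<open>a\<close>, the union below is the class of \<open>a m\<close>.\<close>

definition quotient_act :: "('a, 'm, 'l) mact_scheme \<Rightarrow> ('a \<times> 'a) set \<Rightarrow> ('a set, 'm) mact" where
  "quotient_act A \<rho> = \<lparr>carrier = carrier A // \<rho>, act = (\<lambda>C m. \<Union>a\<in>C. \<rho> `` {a \<cdot>\<^bsub>A\<^esub> m})\<rparr>"

definition free_act :: "('m, 'k) monoid_scheme \<Rightarrow> 'x set \<Rightarrow> ('x \<times> 'm, 'm) mact" where
  "free_act M X = \<lparr>carrier = X \<times> carrier M, act = (\<lambda>(x, m) n. (x, m \<otimes>\<^bsub>M\<^esub> n))\<rparr>"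


section \<open>Presentations\<close>

definition presented_act ::
    "('m, 'k) monoid_scheme \<Rightarrow> 'x set \<Rightarrow> (('x \<times> 'm) \<times> ('x \<times> 'm)) set \<Rightarrow> (('x \<times> 'm) set, 'm) mact" where
  "presented_act M X R = quotient_act (free_act M X) (generated_congruence M (free_act M X) R)"

text \<open>The isomorphism \<open>h\<close> is kept explicit because it determines which element of \<open>A\<close> a
  generator \<open>x \<in> X\<close> denotes, namely \<open>gen_elt M X R h x\<close>.\<close>

definition defined_by_presentation ::
    "('m, 'k) monoid_scheme \<Rightarrow> ('a, 'm, 'l) mact_scheme \<Rightarrow> 'x set \<Rightarrow> (('x \<times> 'm) \<times> ('x \<times> 'm)) set
      \<Rightarrow> (('x \<times> 'm) set \<Rightarrow> 'a) \<Rightarrow> bool" where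
  "defined_by_presentation M A X R h \<longleftrightarrow>
     X \<noteq> {} \<and> R \<subseteq> carrier (free_act M X) \<times> carrier (free_act M X) \<and>
     h \<in> act_iso M (presented_act M X R) A"

definition gen_elt ::
    "('m, 'k) monoid_scheme \<Rightarrow> 'x set \<Rightarrow> (('x \<times> 'm) \<times> ('x \<times> 'm)) set
      \<Rightarrow> (('x \<times> 'm) set \<Rightarrow> 'a) \<Rightarrow> 'x \<Rightarrow> 'a" where
  "gen_elt M X R h x = h (generated_congruence M (free_act M X) R `` {(x, \<one>\<^bsub>M\<^esub>)})"

text \<open>HOL cannot quantify over the type of the generators inside a definition. Natural numbers
  suffice, since every finite generating set can be renamed to a finite set of naturals.\<close>

definition finitely_presented ::
    "('m, 'k) monoid_scheme \<Rightarrow> ('a, 'm, 'l) mact_scheme \<Rightarrow> bool" where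
  "finitely_presented M A \<longleftrightarrow>
     (\<exists>(X :: nat set) R h. finite X \<and> finite R \<and> defined_by_presentation M A X R h)"


section \<open>Wreath products\<close>

text \<open>Elements of \<open>N^S\<close> are extensional functions, i.e. equal to \<open>undefined\<close> outside \<open>S\<close>. The library's
  \<open>product_group\<close> only uses the monoid structure of its factors.\<close>

definition map_monoid :: "('n, 'k) monoid_scheme \<Rightarrow> 'a set \<Rightarrow> ('a \<Rightarrow> 'n) monoid" where
  "map_monoid N S = product_group S (\<lambda>_. N)"

definition const_map :: "'a set \<Rightarrow> 'n \<Rightarrow> 'a \<Rightarrow> 'n" where
  "const_map S n = (\<lambda>a\<in>S. n)"

definition twist :: "('a, 'm, 'l) mact_scheme \<Rightarrow> 'm \<Rightarrow> ('a \<Rightarrow> 'n) \<Rightarrow> 'a \<Rightarrow> 'n" where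
  "twist A m \<phi> = (\<lambda>a\<in>carrier A. \<phi> (a \<cdot>\<^bsub>A\<^esub> m))"

definition wreath_monoid ::
    "('m, 'k) monoid_scheme \<Rightarrow> ('n, 'j) monoid_scheme \<Rightarrow> ('a, 'm, 'l) mact_scheme
      \<Rightarrow> ('m \<times> ('a \<Rightarrow> 'n)) monoid" where
  "wreath_monoid M N A = \<lparr>
     carrier = carrier M \<times> carrier (map_monoid N (carrier A)),
     monoid.mult = (\<lambda>(m, \<theta>) (n, \<phi>).
       (m \<otimes>\<^bsub>M\<^esub> n, \<theta> \<otimes>\<^bsub>map_monoid N (carrier A)\<^esub> twist A m \<phi>)),
     one = (\<one>\<^bsub>M\<^esub>, \<one>\<^bsub>map_monoid N (carrier A)\<^esub>)\<rparr>"

definition wreath_act ::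
    "('a, 'm, 'l) mact_scheme \<Rightarrow> ('b, 'n, 'j) mact_scheme \<Rightarrow> ('a \<times> 'b, 'm \<times> ('a \<Rightarrow> 'n)) mact" where
  "wreath_act A B = \<lparr>
     carrier = carrier A \<times> carrier B,
     act = (\<lambda>(a, b) (m, \<theta>). (a \<cdot>\<^bsub>A\<^esub> m, b \<cdot>\<^bsub>B\<^esub> \<theta> a))\<rparr>"


section \<open>Connectedness\<close>

text \<open>The sequences \<open>\<theta>\<^sub>i\<close>, \<open>\<phi>\<^sub>i\<close>, \<open>\<psi>\<^sub>i\<close> are \<open>t\<close>, \<open>p\<close>, \<open>s\<close>; only their values at \<open>1, \<dots>, k\<close> matter.\<close>

definition connected_maps ::
    "('n, 'k) monoid_scheme \<Rightarrow> 'a set \<Rightarrow> ('a \<Rightarrow> 'n) set \<Rightarrow> 'a \<Rightarrow> ('a \<Rightarrow> 'n) \<Rightarrow> ('a \<Rightarrow> 'n) \<Rightarrow> bool" where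
  "connected_maps N S U a \<theta> \<phi> \<longleftrightarrow>
     (\<exists>(k :: nat) t p s. 1 \<le> k \<and>
        (\<forall>i\<in>{1..k}. s i \<in> carrier (map_monoid N S) \<and>
           (t i \<in> U \<and> p i = const_map S (t i a) \<or> p i \<in> U \<and> t i = const_map S (p i a))) \<and>
        \<theta> = t 1 \<otimes>\<^bsub>map_monoid N S\<^esub> s 1 \<and>
        (\<forall>i\<in>{1..<k}. p i \<otimes>\<^bsub>map_monoid N S\<^esub> s i = t (Suc i) \<otimes>\<^bsub>map_monoid N S\<^esub> s (Suc i)) \<and>
        p k \<otimes>\<^bsub>map_monoid N S\<^esub> s k = \<phi>)"

end

theory Submission
  imports Defs
begin

text \<open>
  Let \<open>B = \<langle>Y | S\<rangle>\<close>. The pairs in \<open>X \<times> Y\<close> generate \<open>A \<wr> B\<close>, subject to the relations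
  \<open>(x,y)(m,1) = (x',y)(m',1)\<close> from \<open>R\<close>, \<open>(x,y)(1,c\<^sub>n) = (x,y')(1,c\<^bsub>n'\<^esub>)\<close> from \<open>S\<close>, and
  \<open>(x,y)(1,u) = (x,y)(1,c\<^bsub>xu\<^esub>)\<close> for \<open>u \<in> U\<close>. Connectedness lets the last family rewrite
  \<open>(x,y)(m,\<theta>) = (x,y)(1,\<theta>)(m,1)\<close> to \<open>(x,y)(m,c\<^sub>n)\<close> with \<open>n = x\<theta>\<close>. If \<open>x m = x' m'\<close> in \<open>A\<close> and
  \<open>y n = y' n'\<close> in \<open>B\<close>, the second family turns \<open>(x,y)(m,c\<^sub>n) = (x,y)(1,c\<^sub>n)(m,1)\<close> into
  \<open>(x,y')(m,c\<^bsub>n'\<^esub>) = (x,y')(m,1)(1,c\<^bsub>n'\<^esub>)\<close>, and the first one replaces \<open>(x,m)\<close> by \<open>(x',m')\<close>.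
\<close>

section \<open>Congruences transported along maps of acts\<close>

text \<open>The two acts may live over different monoids, linked by \<open>\<mu>\<close>: this is
  what later lets consequences over \<open>M\<close> or over \<open>N\<close> be read as
  consequences over the wreath monoid. With \<open>\<mu>\<close> the identity it also yields kernels
  and renamings of generators.\<close>

lemma act_congruence_pullback:
  assumes "monoid_act M F"
    and f: "f \<in> carrier F \<rightarrow> carrier G" and \<mu>: "\<mu> \<in> carrier M \<rightarrow> carrier M'"
    and eq: "\<And>p m. p \<in> carrier F \<Longrightarrow> m \<in> carrier M \<Longrightarrow> f (p \<cdot>\<^bsub>F\<^esub> m) = f p \<cdot>\<^bsub>G\<^esub> \<mu> m"
    and \<rho>: "act_congruence M' G \<rho>"
  shows "act_congruence M F {(p, q). p \<in> carrier F \<and> q \<in> carrier F \<and> (f p, f q) \<in> \<rho>}"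
proof -
  interpret F: monoid_act M F by fact
  have e: "equiv (carrier G) \<rho>"
    and c: "\<And>a b m. (a, b) \<in> \<rho> \<Longrightarrow> m \<in> carrier M' \<Longrightarrow> (a \<cdot>\<^bsub>G\<^esub> m, b \<cdot>\<^bsub>G\<^esub> m) \<in> \<rho>"
    using \<rho> by (auto simp: act_congruence_def)
  have r: "\<And>a. a \<in> carrier G \<Longrightarrow> (a, a) \<in> \<rho>" and s: "sym \<rho>" and t: "trans \<rho>"
    using e by (auto elim!: equivE dest: refl_onD)
  show ?thesis
    unfolding act_congruence_def
  proof (intro conjI equivI allI impI ballI)
    show "{(p, q). p \<in> carrier F \<and> q \<in> carrier F \<and> (f p, f q) \<in> \<rho>} \<subseteq> carrier F \<times> carrier F"
      by auto
    show "refl_on (carrier F) {(p, q). p \<in> carrier F \<and> q \<in> carrier F \<and> (f p, f q) \<in> \<rho>}"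
      using f r by (auto simp: refl_on_def)
    show "sym {(p, q). p \<in> carrier F \<and> q \<in> carrier F \<and> (f p, f q) \<in> \<rho>}"
      using s by (auto simp: sym_def)
    show "trans {(p, q). p \<in> carrier F \<and> q \<in> carrier F \<and> (f p, f q) \<in> \<rho>}"
      using t by (auto simp: trans_def)
  next
    fix a b m
    assume "(a, b) \<in> {(p, q). p \<in> carrier F \<and> q \<in> carrier F \<and> (f p, f q) \<in> \<rho>}" "m \<in> carrier M"
    then show "(a \<cdot>\<^bsub>F\<^esub> m, b \<cdot>\<^bsub>F\<^esub> m) \<in> {(p, q). p \<in> carrier F \<and> q \<in> carrier F \<and> (f p, f q) \<in> \<rho>}"
      using \<mu> by (auto simp: eq F.act_closed intro!: c)
  qed
qed

text \<open>The pullback of \<open>\<rho>\<close> along \<open>f\<close> is a congruence containing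
  \<open>R\<close>, so it contains the least one. Hence only the pairs in \<open>R\<close> have to
  be checked in order to transport all their consequences.\<close>

lemma generated_congruence_image:
  assumes F: "monoid_act M F"
    and f: "f \<in> carrier F \<rightarrow> carrier G" and \<mu>: "\<mu> \<in> carrier M \<rightarrow> carrier M'"
    and eq: "\<And>p m. p \<in> carrier F \<Longrightarrow> m \<in> carrier M \<Longrightarrow> f (p \<cdot>\<^bsub>F\<^esub> m) = f p \<cdot>\<^bsub>G\<^esub> \<mu> m"
    and \<rho>: "act_congruence M' G \<rho>"
    and R: "R \<subseteq> carrier F \<times> carrier F" "\<And>p q. (p, q) \<in> R \<Longrightarrow> (f p, f q) \<in> \<rho>"
    and pq: "(p, q) \<in> generated_congruence M F R"
  shows "(f p, f q) \<in> \<rho>"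
  using pq act_congruence_pullback[OF F f \<mu> eq \<rho>] R
  unfolding generated_congruence_def by blast

lemma act_congruence_Id_on:
  assumes "monoid_act M A"
  shows "act_congruence M A (Id_on (carrier A))"
proof -
  interpret monoid_act M A by fact
  show ?thesis
    by (auto simp: act_congruence_def act_closed refl_on_def sym_def trans_def intro!: equivI)
qed

lemma act_congruence_generated:
  assumes "monoid_act M A" "R \<subseteq> carrier A \<times> carrier A"
  shows "act_congruence M A (generated_congruence M A R)"
proof -
  interpret monoid_act M A by fact
  \<comment> \<open>The full relation belongs to the intersected family, which keeps the
    intersection inside the carrier.\<close>
  have full: "act_congruence M A (carrier A \<times> carrier A)"
    by (auto simp: act_congruence_def act_closed refl_on_def sym_def trans_def intro!: equivI)
  have sub: "generated_congruence M A R \<subseteq> carrier A \<times> carrier A"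
    using full assms by (auto simp: generated_congruence_def)
  show ?thesis
    unfolding act_congruence_def
  proof (intro conjI equivI allI impI ballI)
    show "generated_congruence M A R \<subseteq> carrier A \<times> carrier A" by (rule sub)
    show "refl_on (carrier A) (generated_congruence M A R)"
      by (auto simp: generated_congruence_def act_congruence_def refl_on_def equiv_def)
    show "sym (generated_congruence M A R)"
      unfolding generated_congruence_def act_congruence_def equiv_def sym_def by blast
    show "trans (generated_congruence M A R)"
      unfolding generated_congruence_def act_congruence_def equiv_def
      by (auto intro!: transI dest: transD)
  qed (auto simp: generated_congruence_def act_congruence_def)
qed

lemma quotient_act_class:
  assumes "act_congruence M A \<rho>" "p \<in> carrier A" "m \<in> carrier M"
  shows "(\<rho> `` {p}) \<cdot>\<^bsub>quotient_act A \<rho>\<^esub> m = \<rho> `` {p \<cdot>\<^bsub>A\<^esub> m}"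
proof -
  have e: "equiv (carrier A) \<rho>" using assms by (simp add: act_congruence_def)
  have "\<rho> `` {a \<cdot>\<^bsub>A\<^esub> m} = \<rho> `` {p \<cdot>\<^bsub>A\<^esub> m}" if "a \<in> \<rho> `` {p}" for a
    using assms that by (intro equiv_class_eq[OF e, symmetric]) (auto simp: act_congruence_def)
  moreover have "p \<in> \<rho> `` {p}" by (rule equiv_class_self[OF e assms(2)])
  ultimately have "(\<Union>a\<in>\<rho> `` {p}. \<rho> `` {a \<cdot>\<^bsub>A\<^esub> m}) = \<rho> `` {p \<cdot>\<^bsub>A\<^esub> m}"
    by blast
  then show ?thesis by (simp add: quotient_act_def)
qed

section \<open>Free acts, and presentations expressed by kernels\<close>

lemma carrier_free_act [simp]: "carrier (free_act M X) = X \<times> carrier M"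
  by (simp add: free_act_def)

lemma act_free_act [simp]: "(x, m) \<cdot>\<^bsub>free_act M X\<^esub> n = (x, m \<otimes>\<^bsub>M\<^esub> n)"
  by (simp add: free_act_def)

lemma monoid_act_free_act:
  assumes "monoid M" "X \<noteq> {}"
  shows "monoid_act M (free_act M X)"
proof -
  interpret monoid M by fact
  show ?thesis
    using assms(2) one_closed
    by unfold_locales (auto simp: m_assoc simp del: one_closed)
qed

text \<open>The kernel of the homomorphism from the free act to \<open>A\<close> that extends
  \<open>g\<close>. A presentation amounts to this kernel being the generated congruence while the
  elements \<open>g x\<close> generate \<open>A\<close>, which avoids quotients later on.\<close>

definition gen_kernel ::
    "('m, 'k) monoid_scheme \<Rightarrow> ('a, 'm, 'l) mact_scheme \<Rightarrow> 'x set \<Rightarrow> ('x \<Rightarrow> 'a)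
      \<Rightarrow> (('x \<times> 'm) \<times> ('x \<times> 'm)) set" where
  "gen_kernel M A X g = {((x, m), (x', m')).
     x \<in> X \<and> m \<in> carrier M \<and> x' \<in> X \<and> m' \<in> carrier M \<and> g x \<cdot>\<^bsub>A\<^esub> m = g x' \<cdot>\<^bsub>A\<^esub> m'}"

lemma act_congruence_gen_kernel:
  assumes A: "monoid_act M A" and X: "X \<noteq> {}" and g: "g \<in> X \<rightarrow> carrier A"
  shows "act_congruence M (free_act M X) (gen_kernel M A X g)"
proof -
  interpret monoid_act M A by fact
  \<comment> \<open>The kernel is the pullback of equality on \<open>A\<close> along
    \<open>(x, m) \<mapsto> g x m\<close>.\<close>
  have "gen_kernel M A X g = {(p, q). p \<in> carrier (free_act M X) \<and> q \<in> carrier (free_act M X) \<and>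
      ((\<lambda>(x, m). g x \<cdot>\<^bsub>A\<^esub> m) p, (\<lambda>(x, m). g x \<cdot>\<^bsub>A\<^esub> m) q) \<in> Id_on (carrier A)}"
    using g by (auto simp: gen_kernel_def intro!: act_closed)
  also have "act_congruence M (free_act M X) \<dots>"
    using g
    by (intro act_congruence_pullback[OF monoid_act_free_act[OF monoid_axioms X] _ _ _
          act_congruence_Id_on[OF A], where \<mu> = "\<lambda>m. m"])
       (auto simp: Pi_iff act_closed act_mult)
  finally show ?thesis .
qed

text \<open>As \<open>(x, m)\<close> is \<open>(x, \<one>)\<close> acted on by \<open>m\<close>, the
  isomorphism \<open>h\<close> sends its class to \<open>g x m\<close>. Injectivity of
  \<open>h\<close> then identifies the kernel, and surjectivity shows that the elements
  \<open>g x\<close> generate \<open>A\<close>.\<close>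

lemma defined_by_presentationD:
  assumes A: "monoid_act M A" and h: "defined_by_presentation M A X R h"
  defines "g \<equiv> gen_elt M X R h"
  shows "X \<noteq> {}" and "R \<subseteq> carrier (free_act M X) \<times> carrier (free_act M X)"
    and "g \<in> X \<rightarrow> carrier A"
    and "generated_congruence M (free_act M X) R = gen_kernel M A X g"
    and "\<And>a. a \<in> carrier A \<Longrightarrow> \<exists>x\<in>X. \<exists>m\<in>carrier M. a = g x \<cdot>\<^bsub>A\<^esub> m"
proof -
  interpret monoid_act M A by fact
  let ?F = "free_act M X"
  let ?\<rho> = "generated_congruence M ?F R"
  show X: "X \<noteq> {}" and R: "R \<subseteq> carrier ?F \<times> carrier ?F"
    using h by (auto simp: defined_by_presentation_def)
  have F: "monoid_act M ?F" by (rule monoid_act_free_act[OF monoid_axioms X])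
  have c: "act_congruence M ?F ?\<rho>" by (rule act_congruence_generated[OF F R])
  have e: "equiv (X \<times> carrier M) ?\<rho>" using c by (simp add: act_congruence_def)
  have bij: "bij_betw h ((X \<times> carrier M) // ?\<rho>) (carrier A)"
    and hom: "\<And>C m. C \<in> (X \<times> carrier M) // ?\<rho> \<Longrightarrow> m \<in> carrier M
      \<Longrightarrow> h (C \<cdot>\<^bsub>quotient_act ?F ?\<rho>\<^esub> m) = h C \<cdot>\<^bsub>A\<^esub> m"
    using h by (auto simp: defined_by_presentation_def act_iso_def presented_act_def quotient_act_def)
  have h_class: "h (?\<rho> `` {(x, m)}) = g x \<cdot>\<^bsub>A\<^esub> m" if "x \<in> X" "m \<in> carrier M" for x m
  proof -
    have "(?\<rho> `` {(x, \<one>\<^bsub>M\<^esub>)}) \<cdot>\<^bsub>quotient_act ?F ?\<rho>\<^esub> m = ?\<rho> `` {(x, m)}"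
      using quotient_act_class[OF c, of "(x, \<one>\<^bsub>M\<^esub>)" m] that by simp
    then show ?thesis
      using hom[of "?\<rho> `` {(x, \<one>\<^bsub>M\<^esub>)}" m] that by (simp add: g_def gen_elt_def quotientI)
  qed
  show "g \<in> X \<rightarrow> carrier A"
  proof
    fix x assume "x \<in> X"
    then show "g x \<in> carrier A"
      using bij_betwE[OF bij] by (simp add: g_def gen_elt_def quotientI)
  qed
  have "((x, m), (x', m')) \<in> ?\<rho> \<longleftrightarrow> g x \<cdot>\<^bsub>A\<^esub> m = g x' \<cdot>\<^bsub>A\<^esub> m'"
    if "x \<in> X" "m \<in> carrier M" "x' \<in> X" "m' \<in> carrier M" for x m x' m'
  proof -
    have xm: "(x, m) \<in> X \<times> carrier M" "(x', m') \<in> X \<times> carrier M" using that by simp_all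
    have "((x, m), (x', m')) \<in> ?\<rho> \<longleftrightarrow> ?\<rho> `` {(x, m)} = ?\<rho> `` {(x', m')}"
      by (rule eq_equiv_class_iff[OF e xm, symmetric])
    also have "\<dots> \<longleftrightarrow> h (?\<rho> `` {(x, m)}) = h (?\<rho> `` {(x', m')})"
      by (rule inj_on_eq_iff[OF bij_betw_imp_inj_on[OF bij] quotientI[OF xm(1)] quotientI[OF xm(2)],
            symmetric])
    finally show ?thesis
      unfolding h_class[OF that(1,2)] h_class[OF that(3,4)] .
  qed
  moreover have "?\<rho> \<subseteq> (X \<times> carrier M) \<times> (X \<times> carrier M)"
    using e by (auto simp: equiv_def)
  ultimately show "?\<rho> = gen_kernel M A X g"
    by (auto simp: gen_kernel_def)
  fix a assume "a \<in> carrier A"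
  then obtain C where "C \<in> (X \<times> carrier M) // ?\<rho>" "a = h C"
    using bij by (auto simp: bij_betw_def)
  then show "\<exists>x\<in>X. \<exists>m\<in>carrier M. a = g x \<cdot>\<^bsub>A\<^esub> m"
    using h_class by (elim quotientE) blast
qed

text \<open>The first isomorphism theorem for acts, giving the converse passage from kernel and
  generation to an isomorphism.\<close>

lemma defined_by_presentationI:
  assumes A: "monoid_act M A" and X: "X \<noteq> {}"
    and R: "R \<subseteq> carrier (free_act M X) \<times> carrier (free_act M X)"
    and g: "g \<in> X \<rightarrow> carrier A"
    and ker: "generated_congruence M (free_act M X) R = gen_kernel M A X g"
    and surj: "\<And>a. a \<in> carrier A \<Longrightarrow> \<exists>x\<in>X. \<exists>m\<in>carrier M. a = g x \<cdot>\<^bsub>A\<^esub> m"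
  shows "\<exists>h. defined_by_presentation M A X R h"
proof -
  interpret monoid_act M A by fact
  let ?F = "free_act M X"
  let ?\<rho> = "gen_kernel M A X g"
  have c: "act_congruence M ?F ?\<rho>" by (rule act_congruence_gen_kernel[OF A X g])
  have e: "equiv (X \<times> carrier M) ?\<rho>" using c by (simp add: act_congruence_def)
  \<comment> \<open>Any representative will do, since all members of a kernel class have the same
    value in \<open>A\<close>.\<close>
  define h where "h = (\<lambda>C. let (x, m) = SOME p. p \<in> C in g x \<cdot>\<^bsub>A\<^esub> m)"
  have h_class: "h (?\<rho> `` {(x, m)}) = g x \<cdot>\<^bsub>A\<^esub> m" if "x \<in> X" "m \<in> carrier M" for x m
  proof -
    have "(SOME p. p \<in> ?\<rho> `` {(x, m)}) \<in> ?\<rho> `` {(x, m)}"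
      by (rule someI[of _ "(x, m)"]) (use that in \<open>auto simp: gen_kernel_def\<close>)
    then obtain x' m' where "(SOME p. p \<in> ?\<rho> `` {(x, m)}) = (x', m')"
        and "((x, m), (x', m')) \<in> ?\<rho>"
      by (metis Image_singleton_iff surj_pair)
    then show ?thesis
      by (simp add: h_def gen_kernel_def)
  qed
  have "bij_betw h ((X \<times> carrier M) // ?\<rho>) (carrier A)"
    unfolding bij_betw_def
  proof
    show "inj_on h ((X \<times> carrier M) // ?\<rho>)"
    proof (rule inj_onI)
      fix C D assume C: "C \<in> (X \<times> carrier M) // ?\<rho>" and D: "D \<in> (X \<times> carrier M) // ?\<rho>"
        and hCD: "h C = h D"
      obtain x m where xm: "x \<in> X" "m \<in> carrier M" "C = ?\<rho> `` {(x, m)}"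
        using C by (auto simp: quotient_def)
      obtain x' m' where xm': "x' \<in> X" "m' \<in> carrier M" "D = ?\<rho> `` {(x', m')}"
        using D by (auto simp: quotient_def)
      show "C = D"
        unfolding xm xm' using hCD xm xm' h_class
        by (intro equiv_class_eq[OF e]) (auto simp: gen_kernel_def)
    qed
    show "h ` ((X \<times> carrier M) // ?\<rho>) = carrier A"
    proof (intro equalityI subsetI)
      fix a assume "a \<in> h ` ((X \<times> carrier M) // ?\<rho>)"
      then show "a \<in> carrier A" using g by (auto simp: quotient_def h_class intro!: act_closed)
    next
      fix a assume "a \<in> carrier A"
      then obtain x m where "x \<in> X" "m \<in> carrier M" "a = g x \<cdot>\<^bsub>A\<^esub> m" using surj by blast
      then show "a \<in> h ` ((X \<times> carrier M) // ?\<rho>)"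
        by (intro image_eqI[of _ _ "?\<rho> `` {(x, m)}"]) (auto simp: h_class quotientI)
    qed
  qed
  moreover have "h (C \<cdot>\<^bsub>quotient_act ?F ?\<rho>\<^esub> n) = h C \<cdot>\<^bsub>A\<^esub> n"
    if "C \<in> (X \<times> carrier M) // ?\<rho>" "n \<in> carrier M" for C n
    using that g
    by (auto simp: quotient_def quotient_act_class[OF c] h_class act_mult Pi_iff)
  ultimately have "defined_by_presentation M A X R h"
    using X R
    by (auto simp: defined_by_presentation_def act_iso_def presented_act_def ker quotient_act_def)
  then show ?thesis by blast
qed

lemma finitely_presentedI:
  assumes A: "monoid_act M A" and X: "X \<noteq> {}" "finite X" and "finite R"
    and g: "g \<in> X \<rightarrow> carrier A"
    and surj: "\<And>a. a \<in> carrier A \<Longrightarrow> \<exists>x\<in>X. \<exists>m\<in>carrier M. a = g x \<cdot>\<^bsub>A\<^esub> m"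
    and R: "R \<subseteq> gen_kernel M A X g"
    and least: "\<And>\<rho>. act_congruence M (free_act M X) \<rho> \<Longrightarrow> R \<subseteq> \<rho> \<Longrightarrow> gen_kernel M A X g \<subseteq> \<rho>"
  shows "finitely_presented M A"
proof -
  interpret monoid_act M A by fact
  obtain f :: "_ \<Rightarrow> nat" where f: "inj_on f X"
    using finite_imp_inj_to_nat_seg[OF X(2)] by blast
  let ?Z = "f ` X"
  let ?g = "g \<circ> inv_into X f"
  let ?f = "map_prod f (\<lambda>m. m)"
  let ?R = "map_prod ?f ?f ` R"
  have gf: "?g (f x) = g x" if "x \<in> X" for x using that f by simp
  have Z: "?Z \<noteq> {}" using X by simp
  have RK: "?R \<subseteq> gen_kernel M A ?Z ?g"
  proof
    fix r assume "r \<in> ?R"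
    then obtain x m x' m' where "((x, m), (x', m')) \<in> R" "r = ((f x, m), (f x', m'))"
      by auto
    moreover from this R have "((x, m), (x', m')) \<in> gen_kernel M A X g" by blast
    ultimately show "r \<in> gen_kernel M A ?Z ?g"
      using f by (simp add: gen_kernel_def)
  qed
  then have RF: "?R \<subseteq> carrier (free_act M ?Z) \<times> carrier (free_act M ?Z)"
    by (force simp: gen_kernel_def)
  have gZ: "?g \<in> ?Z \<rightarrow> carrier A" using g f by auto
  have "gen_kernel M A ?Z ?g \<subseteq> \<rho>"
    if \<rho>: "act_congruence M (free_act M ?Z) \<rho>" "?R \<subseteq> \<rho>" for \<rho>
  proof
    fix r assume "r \<in> gen_kernel M A ?Z ?g"
    then obtain x m x' m' where r: "r = ((f x, m), (f x', m'))"
        and k: "((x, m), (x', m')) \<in> gen_kernel M A X g"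
      using f by (auto simp: gen_kernel_def)
    \<comment> \<open>Pulling \<open>\<rho>\<close> back along the renaming gives a congruence on
      the original free act, where \<open>least\<close> applies.\<close>
    let ?P = "{(p, q). p \<in> carrier (free_act M X) \<and> q \<in> carrier (free_act M X) \<and> (?f p, ?f q) \<in> \<rho>}"
    have "act_congruence M (free_act M X) ?P"
      by (rule act_congruence_pullback[OF monoid_act_free_act[OF monoid_axioms X(1)] _ _ _ \<rho>(1),
            where \<mu> = "\<lambda>m. m"]) auto
    moreover have "R \<subseteq> ?P" using R \<rho>(2) by (fastforce simp: gen_kernel_def)
    ultimately have "gen_kernel M A X g \<subseteq> ?P" by (rule least)
    then show "r \<in> \<rho>" using k r by auto
  qed
  \<comment> \<open>The kernel is itself a congruence containing \<open>?R\<close>, hence one of the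
    intersected relations; the other inclusion was just shown.\<close>
  then have "generated_congruence M (free_act M ?Z) ?R = gen_kernel M A ?Z ?g"
    using act_congruence_gen_kernel[OF A Z gZ] RK
    unfolding generated_congruence_def by blast
  then have "\<exists>h. defined_by_presentation M A ?Z ?R h"
    using surj gf by (intro defined_by_presentationI[OF A Z RF gZ]) force+
  then show ?thesis
    using X \<open>finite R\<close> unfolding finitely_presented_def by blast
qed

section \<open>The monoid of maps, the wreath monoid and its act\<close>

lemma carrier_map_monoid: "carrier (map_monoid N S) = S \<rightarrow>\<^sub>E carrier N"
  by (simp add: map_monoid_def)

lemma mult_map_monoid: "\<theta> \<otimes>\<^bsub>map_monoid N S\<^esub> \<phi> = (\<lambda>a\<in>S. \<theta> a \<otimes>\<^bsub>N\<^esub> \<phi> a)"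
  by (simp add: map_monoid_def)

lemma one_map_monoid: "\<one>\<^bsub>map_monoid N S\<^esub> = const_map S \<one>\<^bsub>N\<^esub>"
  by (simp add: map_monoid_def const_map_def)

lemma const_map_apply: "a \<in> S \<Longrightarrow> const_map S n a = n"
  by (simp add: const_map_def)

lemma const_map_in_carrier: "n \<in> carrier N \<Longrightarrow> const_map S n \<in> carrier (map_monoid N S)"
  by (simp add: carrier_map_monoid const_map_def)

lemma monoid_map_monoid:
  assumes "monoid N"
  shows "monoid (map_monoid N S)"
proof -
  interpret monoid N by fact
  show ?thesis
    by (rule monoidI)
       (auto simp: carrier_map_monoid mult_map_monoid one_map_monoid const_map_def m_assoc PiE_iff
          fun_eq_iff extensional_def)
qed

locale wreath_acts = A: monoid_act M A + B: monoid_act N B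
  for M :: "('m, 'k) monoid_scheme" and A :: "('a, 'm, 'l) mact_scheme"
    and N :: "('n, 'j) monoid_scheme" and B :: "('b, 'n, 'i) mact_scheme"
begin

abbreviation "NA \<equiv> map_monoid N (carrier A)"
abbreviation "W \<equiv> wreath_monoid M N A"
abbreviation "c \<equiv> const_map (carrier A)"

sublocale NA: monoid NA
  by (rule monoid_map_monoid) (rule B.monoid_axioms)

lemma carrier_wreath [simp]: "carrier W = carrier M \<times> carrier NA"
  by (simp add: wreath_monoid_def)

lemma mult_wreath [simp]:
  "(m, \<theta>) \<otimes>\<^bsub>W\<^esub> (n, \<phi>) = (m \<otimes>\<^bsub>M\<^esub> n, \<theta> \<otimes>\<^bsub>NA\<^esub> twist A m \<phi>)"
  by (simp add: wreath_monoid_def)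

lemma one_wreath: "\<one>\<^bsub>W\<^esub> = (\<one>\<^bsub>M\<^esub>, \<one>\<^bsub>NA\<^esub>)"
  by (simp add: wreath_monoid_def)

lemma twist_closed [simp]:
  "m \<in> carrier M \<Longrightarrow> \<phi> \<in> carrier NA \<Longrightarrow> twist A m \<phi> \<in> carrier NA"
  by (auto simp: carrier_map_monoid twist_def A.act_closed)

lemma twist_one_left [simp]: "\<phi> \<in> carrier NA \<Longrightarrow> twist A \<one>\<^bsub>M\<^esub> \<phi> = \<phi>"
  by (auto simp: carrier_map_monoid twist_def A.act_one PiE_iff extensional_def fun_eq_iff)

text \<open>Consequently \<open>(m, \<one>)\<close> and \<open>(\<one>, c n)\<close> commute in
  \<open>W\<close>, with product \<open>(m, c n)\<close> in either order. The relations from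
  \<open>R\<close> and from \<open>S\<close> can therefore be applied independently.\<close>

lemma twist_const [simp]: "m \<in> carrier M \<Longrightarrow> twist A m (c n) = c n"
  by (auto simp: twist_def const_map_def A.act_closed fun_eq_iff)

lemma twist_one_right [simp]: "m \<in> carrier M \<Longrightarrow> twist A m \<one>\<^bsub>NA\<^esub> = \<one>\<^bsub>NA\<^esub>"
  by (simp add: one_map_monoid)

lemma twist_mult_right:
  "m \<in> carrier M \<Longrightarrow> twist A m (\<theta> \<otimes>\<^bsub>NA\<^esub> \<phi>) = twist A m \<theta> \<otimes>\<^bsub>NA\<^esub> twist A m \<phi>"
  by (auto simp: mult_map_monoid twist_def A.act_closed fun_eq_iff)

lemma twist_mult_left:
  "m \<in> carrier M \<Longrightarrow> n \<in> carrier M \<Longrightarrow> twist A (m \<otimes>\<^bsub>M\<^esub> n) \<phi> = twist A m (twist A n \<phi>)"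
  by (auto simp: twist_def A.act_closed A.act_mult fun_eq_iff)

lemma const_mult: "c n \<otimes>\<^bsub>NA\<^esub> c n' = c (n \<otimes>\<^bsub>N\<^esub> n')"
  by (auto simp: mult_map_monoid const_map_def fun_eq_iff)

lemma const_closed [simp]: "n \<in> carrier N \<Longrightarrow> c n \<in> carrier NA"
  by (rule const_map_in_carrier)

lemma map_apply_closed: "\<theta> \<in> carrier NA \<Longrightarrow> a \<in> carrier A \<Longrightarrow> \<theta> a \<in> carrier N"
  by (auto simp: carrier_map_monoid)

text \<open>\<open>W\<close> is a semidirect product: \<open>twist A\<close> is a left action of
  \<open>M\<close> on \<open>NA\<close> by monoid endomorphisms.\<close>

lemma monoid_wreath: "monoid W"
proof (rule monoidI)
  fix x y z assume "x \<in> carrier W" "y \<in> carrier W" "z \<in> carrier W"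
  then show "x \<otimes>\<^bsub>W\<^esub> y \<otimes>\<^bsub>W\<^esub> z = x \<otimes>\<^bsub>W\<^esub> (y \<otimes>\<^bsub>W\<^esub> z)"
    by (auto simp: twist_mult_right twist_mult_left A.m_assoc NA.m_assoc)
qed (auto simp: one_wreath)

lemma carrier_wreath_act [simp]: "carrier (wreath_act A B) = carrier A \<times> carrier B"
  by (simp add: wreath_act_def)

lemma act_wreath_act [simp]:
  "(a, b) \<cdot>\<^bsub>wreath_act A B\<^esub> (m, \<theta>) = (a \<cdot>\<^bsub>A\<^esub> m, b \<cdot>\<^bsub>B\<^esub> \<theta> a)"
  by (simp add: wreath_act_def)

text \<open>The twist records that, once \<open>m\<close> has acted, the second map is evaluated at
  \<open>a m\<close> instead of \<open>a\<close>.\<close>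

lemma monoid_act_wreath: "monoid_act W (wreath_act A B)"
proof -
  interpret W: monoid W by (rule monoid_wreath)
  show ?thesis
    using A.nonempty B.nonempty
    by unfold_locales
       (auto simp: A.act_closed B.act_closed A.act_mult B.act_mult A.act_one B.act_one one_wreath
         one_map_monoid const_map_def mult_map_monoid map_apply_closed twist_def)
qed

section \<open>The presentation of the wreath product\<close>

text \<open>Each family is an image of a product of the given sets, so finiteness is immediate.
  Relations of \<open>R\<close> are copied for every \<open>y\<close>, those of \<open>S\<close> for
  every \<open>x\<close>.\<close>

definition wreath_relations ::
  "'x set \<Rightarrow> (('x \<times> 'm) \<times> ('x \<times> 'm)) set \<Rightarrow> ('x \<Rightarrow> 'a) \<Rightarrow> 'y set \<Rightarrow> (('y \<times> 'n) \<times> ('y \<times> 'n)) set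
    \<Rightarrow> ('a \<Rightarrow> 'n) set
    \<Rightarrow> ((('x \<times> 'y) \<times> ('m \<times> ('a \<Rightarrow> 'n))) \<times> (('x \<times> 'y) \<times> ('m \<times> ('a \<Rightarrow> 'n)))) set" where
  "wreath_relations X R g Y S U =
     (\<lambda>(((x, m), (x', m')), y). (((x, y), (m, \<one>\<^bsub>NA\<^esub>)), ((x', y), (m', \<one>\<^bsub>NA\<^esub>)))) ` (R \<times> Y) \<union>
     (\<lambda>(x, ((y, n), (y', n'))). (((x, y), (\<one>\<^bsub>M\<^esub>, c n)), ((x, y'), (\<one>\<^bsub>M\<^esub>, c n')))) ` (X \<times> S) \<union>
     (\<lambda>((x, y), u). (((x, y), (\<one>\<^bsub>M\<^esub>, u)), ((x, y), (\<one>\<^bsub>M\<^esub>, c (u (g x)))))) ` ((X \<times> Y) \<times> U)"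

text \<open>Each step of a connecting sequence exchanges some \<open>u \<in> U\<close> with the
  constant \<open>c (u a)\<close> in front of a common right factor. In the free act this is a
  relation \<open>rel\<close>, or its reverse, acted on by that factor.\<close>

lemma connected_maps_congruent:
  assumes conn: "connected_maps N (carrier A) U a \<theta> \<phi>"
    and U: "U \<subseteq> carrier NA" and a: "a \<in> carrier A" and z: "z \<in> Z"
    and \<rho>: "act_congruence W (free_act W Z) \<rho>"
    and rel: "\<And>u. u \<in> U \<Longrightarrow> ((z, (\<one>\<^bsub>M\<^esub>, u)), (z, (\<one>\<^bsub>M\<^esub>, c (u a)))) \<in> \<rho>"
  shows "((z, (\<one>\<^bsub>M\<^esub>, \<theta>)), (z, (\<one>\<^bsub>M\<^esub>, \<phi>))) \<in> \<rho>"
proof -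
  have s: "sym \<rho>" and t: "trans \<rho>"
    and mult: "\<And>p q w. (p, q) \<in> \<rho> \<Longrightarrow> w \<in> carrier W
      \<Longrightarrow> (p \<cdot>\<^bsub>free_act W Z\<^esub> w, q \<cdot>\<^bsub>free_act W Z\<^esub> w) \<in> \<rho>"
    using \<rho> by (auto simp: act_congruence_def equiv_def)
  obtain k and v p r :: "nat \<Rightarrow> 'a \<Rightarrow> 'n" where k: "1 \<le> k"
    and step: "\<And>i. i \<in> {1..k} \<Longrightarrow> r i \<in> carrier NA \<and>
      (v i \<in> U \<and> p i = c (v i a) \<or> p i \<in> U \<and> v i = c (p i a))"
    and start: "\<theta> = v 1 \<otimes>\<^bsub>NA\<^esub> r 1" and last: "p k \<otimes>\<^bsub>NA\<^esub> r k = \<phi>"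
    and link: "\<And>i. i \<in> {1..<k} \<Longrightarrow> p i \<otimes>\<^bsub>NA\<^esub> r i = v (Suc i) \<otimes>\<^bsub>NA\<^esub> r (Suc i)"
    using conn unfolding connected_maps_def by blast
  have one: "((z, (\<one>\<^bsub>M\<^esub>, v i \<otimes>\<^bsub>NA\<^esub> r i)), (z, (\<one>\<^bsub>M\<^esub>, p i \<otimes>\<^bsub>NA\<^esub> r i))) \<in> \<rho>"
    if i: "i \<in> {1..k}" for i
  proof -
    have "((z, (\<one>\<^bsub>M\<^esub>, v i)), (z, (\<one>\<^bsub>M\<^esub>, p i))) \<in> \<rho>"
      using step[OF i] rel symD[OF s] by metis
    from mult[OF this, of "(\<one>\<^bsub>M\<^esub>, r i)"] step[OF i] show ?thesis by simp
  qed
  \<comment> \<open>The induction starts at 1, where the sequence begins with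
    \<open>\<theta>\<close>; \<open>link\<close> joins the end of step \<open>i\<close> to the start
    of step \<open>Suc i\<close>.\<close>
  have "((z, (\<one>\<^bsub>M\<^esub>, \<theta>)), (z, (\<one>\<^bsub>M\<^esub>, p i \<otimes>\<^bsub>NA\<^esub> r i))) \<in> \<rho>" if "1 \<le> i" "i \<le> k" for i
    using that
  proof (induction i rule: nat_induct_at_least)
    case base
    then show ?case using one[of 1] start by simp
  next
    case (Suc i)
    then show ?case using one[of "Suc i"] link[of i] t by (auto dest: transD)
  qed
  from this[OF k order_refl] last show ?thesis by simp
qed

lemma finitely_presented_wreath:
  assumes X: "finite X" "finite R" "defined_by_presentation M A X R h"
    and Y: "finite Y" "finite S" "defined_by_presentation N B Y S k"
    and U: "finite U" "U \<subseteq> carrier NA"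
    and conn: "\<And>\<theta> x. \<theta> \<in> carrier NA \<Longrightarrow> x \<in> X \<Longrightarrow>
      \<theta> = c (\<theta> (gen_elt M X R h x)) \<or>
      connected_maps N (carrier A) U (gen_elt M X R h x) \<theta> (c (\<theta> (gen_elt M X R h x)))"
  shows "finitely_presented W (wreath_act A B)"
proof -
  define g where "g = gen_elt M X R h"
  define g' where "g' = gen_elt N Y S k"
  note presA = defined_by_presentationD[OF A.monoid_act_axioms X(3), folded g_def]
  note presB = defined_by_presentationD[OF B.monoid_act_axioms Y(3), folded g'_def]
  note conn = conn[folded g_def]
  let ?Z = "X \<times> Y"
  let ?T = "wreath_relations X R g Y S U"
  let ?g = "map_prod g g'"
  have g: "g x \<in> carrier A" if "x \<in> X" for x using presA(3) that by auto
  have g': "g' y \<in> carrier B" if "y \<in> Y" for y using presB(3) that by auto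
  have RK: "R \<subseteq> gen_kernel M A X g"
    unfolding presA(4)[symmetric] by (auto simp: generated_congruence_def)
  have SK: "S \<subseteq> gen_kernel N B Y g'"
    unfolding presB(4)[symmetric] by (auto simp: generated_congruence_def)
  show ?thesis
  proof (rule finitely_presentedI[OF monoid_act_wreath, where X = ?Z and R = ?T and g = ?g])
    show "?Z \<noteq> {}" using presA(1) presB(1) by auto
    show "finite ?Z" using X Y by simp
    show "finite ?T" using X Y U by (simp add: wreath_relations_def)
    show "?g \<in> ?Z \<rightarrow> carrier (wreath_act A B)" using g g' by auto
  next
    fix d assume "d \<in> carrier (wreath_act A B)"
    then obtain a b where d: "d = (a, b)" "a \<in> carrier A" "b \<in> carrier B" by auto
    obtain x m where x: "x \<in> X" "m \<in> carrier M" "a = g x \<cdot>\<^bsub>A\<^esub> m" using presA(5) d by blast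
    obtain y n where y: "y \<in> Y" "n \<in> carrier N" "b = g' y \<cdot>\<^bsub>B\<^esub> n" using presB(5) d by blast
    \<comment> \<open>The constant map delivers \<open>n\<close> to the second component whichever
      point \<open>g x\<close> is.\<close>
    have "d = ?g (x, y) \<cdot>\<^bsub>wreath_act A B\<^esub> (m, c n)"
      using d x y g by (simp add: const_map_def)
    then show "\<exists>z\<in>?Z. \<exists>w\<in>carrier W. d = ?g z \<cdot>\<^bsub>wreath_act A B\<^esub> w"
      using x y by (intro bexI[of _ "(x, y)"] bexI[of _ "(m, c n)"]) auto
  next
    have RK': "x \<in> X \<and> m \<in> carrier M \<and> x' \<in> X \<and> m' \<in> carrier M \<and> g x \<cdot>\<^bsub>A\<^esub> m = g x' \<cdot>\<^bsub>A\<^esub> m'"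
      if "((x, m), (x', m')) \<in> R" for x m x' m'
      using RK that by (auto simp: gen_kernel_def)
    have SK': "y \<in> Y \<and> n \<in> carrier N \<and> y' \<in> Y \<and> n' \<in> carrier N \<and> g' y \<cdot>\<^bsub>B\<^esub> n = g' y' \<cdot>\<^bsub>B\<^esub> n'"
      if "((y, n), (y', n')) \<in> S" for y n y' n'
      using SK that by (auto simp: gen_kernel_def)
    \<comment> \<open>Soundness: a map acts on \<open>(g x, g' y)\<close> only through its value at
      \<open>g x\<close>, so \<open>u\<close> and \<open>c (u (g x))\<close> agree there.\<close>
    show "?T \<subseteq> gen_kernel W (wreath_act A B) ?Z ?g"
      using U(2) g g'
      unfolding wreath_relations_def one_map_monoid
      by (intro Un_least image_subsetI)
        (auto simp: gen_kernel_def const_map_apply map_apply_closed dest!: RK' SK')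
  next
    fix \<rho> assume \<rho>: "act_congruence W (free_act W ?Z) \<rho>" and T: "?T \<subseteq> \<rho>"
    have sy: "sym \<rho>" and tr: "trans \<rho>"
      and rf: "\<And>p. p \<in> carrier (free_act W ?Z) \<Longrightarrow> (p, p) \<in> \<rho>"
      and mult: "\<And>p q w. (p, q) \<in> \<rho> \<Longrightarrow> w \<in> carrier W
        \<Longrightarrow> (p \<cdot>\<^bsub>free_act W ?Z\<^esub> w, q \<cdot>\<^bsub>free_act W ?Z\<^esub> w) \<in> \<rho>"
      using \<rho> by (auto simp: act_congruence_def equiv_def dest: refl_onD)
    have T1: "(((x, y), (m, \<one>\<^bsub>NA\<^esub>)), ((x', y), (m', \<one>\<^bsub>NA\<^esub>))) \<in> \<rho>"
      if "((x, m), (x', m')) \<in> R" "y \<in> Y" for x m x' m' y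
      using that T by (force simp: wreath_relations_def)
    have T2: "(((x, y), (\<one>\<^bsub>M\<^esub>, c n)), ((x, y'), (\<one>\<^bsub>M\<^esub>, c n'))) \<in> \<rho>"
      if "((y, n), (y', n')) \<in> S" "x \<in> X" for x y n y' n'
      using that T by (force simp: wreath_relations_def)
    have T3: "(((x, y), (\<one>\<^bsub>M\<^esub>, u)), ((x, y), (\<one>\<^bsub>M\<^esub>, c (u (g x))))) \<in> \<rho>"
      if "u \<in> U" "x \<in> X" "y \<in> Y" for x y u
      using that
      by (intro subsetD[OF T[unfolded wreath_relations_def]] UnI2 image_eqI[of _ _ "((x, y), u)"]) auto
    \<comment> \<open>Proved first for \<open>m = \<one>\<close>, then acted on by
      \<open>(m, \<one>)\<close>, which leaves the map unchanged. A connecting sequence has at least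
      one step, so the case of constant \<open>\<theta>\<close> is settled by reflexivity.\<close>
    have to_const: "(((x, y), (m, \<theta>)), ((x, y), (m, c (\<theta> (g x))))) \<in> \<rho>"
      if "x \<in> X" "y \<in> Y" "m \<in> carrier M" "\<theta> \<in> carrier NA" for x y m \<theta>
    proof -
      have cl: "c (\<theta> (g x)) \<in> carrier NA" using that g by (simp add: map_apply_closed)
      have "(((x, y), (\<one>\<^bsub>M\<^esub>, \<theta>)), ((x, y), (\<one>\<^bsub>M\<^esub>, c (\<theta> (g x))))) \<in> \<rho>"
        using conn[OF that(4,1)]
      proof
        assume "\<theta> = c (\<theta> (g x))"
        then show ?thesis using that rf[of "((x, y), (\<one>\<^bsub>M\<^esub>, \<theta>))"] by simp
      next
        assume "connected_maps N (carrier A) U (g x) \<theta> (c (\<theta> (g x)))"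
        from connected_maps_congruent[OF this U(2) g[OF that(1)] _ \<rho>, of "(x, y)"] that
        show ?thesis by (simp add: T3)
      qed
      from mult[OF this, of "(m, \<one>\<^bsub>NA\<^esub>)"] that cl show ?thesis by simp
    qed
    \<comment> \<open>For fixed \<open>y\<close>, the map
      \<open>(x, m) \<mapsto> ((x, y), (m, \<one>))\<close> carries \<open>R\<close> into
      \<open>\<rho>\<close>, hence also everything that \<open>R\<close> generates. Acting by
      \<open>(\<one>, c n)\<close> then inserts the constant.\<close>
    have change_A: "(((x, y), (m, c n)), ((x', y), (m', c n))) \<in> \<rho>"
      if k: "((x, m), (x', m')) \<in> gen_kernel M A X g" and "y \<in> Y" "n \<in> carrier N" for x m x' m' y n
    proof -
      have "((\<lambda>(x, m). ((x, y), (m, \<one>\<^bsub>NA\<^esub>))) (x, m), (\<lambda>(x, m). ((x, y), (m, \<one>\<^bsub>NA\<^esub>))) (x', m')) \<in> \<rho>"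
        by (rule generated_congruence_image[OF monoid_act_free_act[OF A.monoid_axioms presA(1)]
              _ _ _ \<rho> presA(2) _ k[folded presA(4)], where \<mu> = "\<lambda>m. (m, \<one>\<^bsub>NA\<^esub>)"])
           (use \<open>y \<in> Y\<close> in \<open>auto intro: T1\<close>)
      then have "(((x, y), (m, \<one>\<^bsub>NA\<^esub>)), ((x', y), (m', \<one>\<^bsub>NA\<^esub>))) \<in> \<rho>" by simp
      from mult[OF this, of "(\<one>\<^bsub>M\<^esub>, c n)"] that show ?thesis by (simp add: gen_kernel_def)
    qed
    \<comment> \<open>The same transport for \<open>S\<close> with \<open>x\<close> fixed:
      \<open>n \<mapsto> (\<one>, c n)\<close> is multiplicative by \<open>const_mult\<close>.
      Acting by \<open>(m, \<one>)\<close> then inserts \<open>m\<close>.\<close>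
    have change_B: "(((x, y), (m, c n)), ((x, y'), (m, c n'))) \<in> \<rho>"
      if k: "((y, n), (y', n')) \<in> gen_kernel N B Y g'" and "x \<in> X" "m \<in> carrier M" for x m y n y' n'
    proof -
      have "((\<lambda>(y, n). ((x, y), (\<one>\<^bsub>M\<^esub>, c n))) (y, n), (\<lambda>(y, n). ((x, y), (\<one>\<^bsub>M\<^esub>, c n))) (y', n')) \<in> \<rho>"
        by (rule generated_congruence_image[OF monoid_act_free_act[OF B.monoid_axioms presB(1)]
              _ _ _ \<rho> presB(2) _ k[folded presB(4)], where \<mu> = "\<lambda>n. (\<one>\<^bsub>M\<^esub>, c n)"])
           (use \<open>x \<in> X\<close> in \<open>auto intro: T2 simp: const_mult\<close>)
      then have "(((x, y), (\<one>\<^bsub>M\<^esub>, c n)), ((x, y'), (\<one>\<^bsub>M\<^esub>, c n'))) \<in> \<rho>" by simp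
      from mult[OF this, of "(m, \<one>\<^bsub>NA\<^esub>)"] that show ?thesis by (simp add: gen_kernel_def)
    qed
    show "gen_kernel W (wreath_act A B) ?Z ?g \<subseteq> \<rho>"
    proof
      fix r assume "r \<in> gen_kernel W (wreath_act A B) ?Z ?g"
      then obtain x y m \<theta> x' y' m' \<theta>' where r: "r = (((x, y), (m, \<theta>)), ((x', y'), (m', \<theta>')))"
        and xy: "x \<in> X" "y \<in> Y" "m \<in> carrier M" "\<theta> \<in> carrier NA"
        and xy': "x' \<in> X" "y' \<in> Y" "m' \<in> carrier M" "\<theta>' \<in> carrier NA"
        and eq: "g x \<cdot>\<^bsub>A\<^esub> m = g x' \<cdot>\<^bsub>A\<^esub> m'"
          "g' y \<cdot>\<^bsub>B\<^esub> \<theta> (g x) = g' y' \<cdot>\<^bsub>B\<^esub> \<theta>' (g x')"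
        by (auto simp: gen_kernel_def)
      have n: "\<theta> (g x) \<in> carrier N" "\<theta>' (g x') \<in> carrier N"
        using xy xy' g by (auto simp: map_apply_closed)
      \<comment> \<open>The order matters: \<open>\<theta>\<close> is frozen to its value at
        \<open>g x\<close> while \<open>x\<close> is still the generator. Once the map is constant,
        \<open>y\<close> and then \<open>x\<close> can be exchanged, and the constant is finally
        unfrozen to \<open>\<theta>'\<close> at \<open>g x'\<close>.\<close>
      have "(((x, y), (m, \<theta>)), ((x, y), (m, c (\<theta> (g x))))) \<in> \<rho>"
        using to_const xy by blast
      moreover have "(((x, y), (m, c (\<theta> (g x)))), ((x, y'), (m, c (\<theta>' (g x'))))) \<in> \<rho>"
        using change_B xy xy' eq n by (simp add: gen_kernel_def)
      moreover have "(((x, y'), (m, c (\<theta>' (g x')))), ((x', y'), (m', c (\<theta>' (g x'))))) \<in> \<rho>"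
        using change_A xy xy' eq n by (simp add: gen_kernel_def)
      moreover have "(((x', y'), (m', c (\<theta>' (g x')))), ((x', y'), (m', \<theta>'))) \<in> \<rho>"
        using to_const xy' sy by (blast dest: symD)
      ultimately show "r \<in> \<rho>" unfolding r using tr by (blast dest: transD)
    qed
  qed
qed

end

theorem proposition5p5:
  fixes M :: "('m, 'k) monoid_scheme" and N :: "('n, 'j) monoid_scheme"
    and A :: "('a, 'm, 'l) mact_scheme" and B :: "('b, 'n, 'i) mact_scheme"
    and X :: "'x set" and R :: "(('x \<times> 'm) \<times> ('x \<times> 'm)) set"
    and h :: "('x \<times> 'm) set \<Rightarrow> 'a"
  assumes "monoid M" and "monoid N"
    and "monoid_act M A" and "monoid_act N B"
    and "finite X" and "finite R" and "defined_by_presentation M A X R h"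
    and "finitely_presented N B"
    and "\<exists>U. finite U \<and> U \<subseteq> carrier (map_monoid N (carrier A)) \<and>
      (\<forall>\<theta>\<in>carrier (map_monoid N (carrier A)). \<forall>x\<in>X.
         \<theta> = const_map (carrier A) (\<theta> (gen_elt M X R h x)) \<or>
         connected_maps N (carrier A) U (gen_elt M X R h x) \<theta>
           (const_map (carrier A) (\<theta> (gen_elt M X R h x))))"
  shows "finitely_presented (wreath_monoid M N A) (wreath_act A B)"
proof -
  interpret wreath_acts M A N B using assms(3,4) by (simp add: wreath_acts_def)
  obtain Y :: "nat set" and S k where Y: "finite Y" "finite S" "defined_by_presentation N B Y S k"
    using assms(8) unfolding finitely_presented_def by blast
  obtain U where U: "finite U" "U \<subseteq> carrier NA"
    and conn: "\<forall>\<theta>\<in>carrier NA. \<forall>x\<in>X. \<theta> = c (\<theta> (gen_elt M X R h x)) \<or>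
      connected_maps N (carrier A) U (gen_elt M X R h x) \<theta> (c (\<theta> (gen_elt M X R h x)))"
    using assms(9) by blast
  show ?thesis
    by (rule finitely_presented_wreath[OF assms(5-7) Y U conn[rule_format]])
qed

end
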